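(* Let $m\ge2$. If $\mathcal{B}=\{B_i : 1\leq i\leq m\}$ is an $(n,m;k_1,k_2,\dots,k_m;\lambda_1,\lambda_2,\dots,\lambda_m)$-BGSEDF, then $\mathcal{B}$ is an $(n,m,(k_1,k_2,\dots,k_m),a=\sum_{1\leq i\leq m}k_i,\lambda)$-BSWEDF for some $\lambda$ with $\lambda\leq\sum_{1\leq i\leq m}\frac{\lambda_i\widetilde{k}}{k_i}$, where $\widetilde{k}=\mathrm{lcm}(k_1,\dots,k_m)$.
   Context: Let $G$ be an additive Abelian group of order $n$ with identity $0$. For multi-sets $B_1,B_2$ of elements of $G$, $D(B_1,B_2)$ is the multi-set $\{x-y : x\in B_1,\ y\in B_2\}$; $c\boxtimes B$ is the multi-set in which each element of $B$ is repeated $c$ times; unions are multi-set unions. Let $\mathcal{B}=\{B_i : 1\le i\le m\}$ be a family of pairwise disjoint nonempty subsets of $G$ with $k_i=|B_i|$. $\mathcal{B}$ is an $(n,m;k_1,\dots,k_m;\lambda_1,\dots,\lambda_m)$-bounded generalized strong external difference family (BGSEDF) if for each $1\le i\le m$, $\bigcup_{1\le j\le m,\ j\ne i}D(B_i,B_j)\subseteq\lambda_i\boxtimes(G\setminus\{0\})$. With $K=(k_1,\dots,k_m)$, $a=\sum_i k_i$, $\widetilde{k}=\mathrm{lcm}(k_1,\dots,k_m)$ and $\widetilde{B}_i=\frac{\widetilde{k}}{k_i}\boxtimes B_i$, $\mathcal{B}$ is an $(n,m,K,a,\lambda)$-BSWEDF (bounded standard weighted external difference family) if $\lambda$ is the smallest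 positive integer such that $\bigcup_{1\le i\ne j\le m}D(B_i,\widetilde{B}_j)\subseteq\lambda\boxtimes(G\setminus\{0\})$. *)

theory Defs
  imports Complex_Main "HOL-Library.Multiset" "HOL-Library.Disjoint_Sets"
begin

text \<open>
  The finite Abelian group is the type \<open>'a\<close>.  A family is indexed by \<open>{1..m}\<close>; values of
  the functions \<open>B\<close>, \<open>k\<close> and \<open>l\<close> outside that range are irrelevant.
\<close>

definition diff_mset :: "'a::ab_group_add multiset \<Rightarrow> 'a multiset \<Rightarrow> 'a multiset" where
  "diff_mset M N = (\<Sum>x\<in>#M. {# x - y. y \<in># N #})"

text \<open>The multiset sums \<open>+\<close> and \<open>\<Sum>\<close> add multiplicities; \<open>\<union>#\<close> would take their maximum.\<close>

definition disjoint_blocks ::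
    "nat \<Rightarrow> nat \<Rightarrow> (nat \<Rightarrow> nat) \<Rightarrow> (nat \<Rightarrow> 'a::{ab_group_add,finite} set) \<Rightarrow> bool" where
  "disjoint_blocks n m k B \<longleftrightarrow>
     card (UNIV :: 'a set) = n \<and> disjoint_family_on B {1..m} \<and>
     (\<forall>i\<in>{1..m}. B i \<noteq> {} \<and> card (B i) = k i)"

definition BGSEDF ::
    "nat \<Rightarrow> nat \<Rightarrow> (nat \<Rightarrow> nat) \<Rightarrow> (nat \<Rightarrow> nat) \<Rightarrow> (nat \<Rightarrow> 'a::{ab_group_add,finite} set) \<Rightarrow> bool" where
  "BGSEDF n m k l B \<longleftrightarrow>
     disjoint_blocks n m k B \<and>
     (\<forall>i\<in>{1..m}. (\<Sum>j\<in>{1..m} - {i}. diff_mset (mset_set (B i)) (mset_set (B j)))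
        \<subseteq># repeat_mset (l i) (mset_set (UNIV - {0})))"

definition lcm_sizes :: "nat \<Rightarrow> (nat \<Rightarrow> nat) \<Rightarrow> nat" where
  "lcm_sizes m k = Lcm (k ` {1..m})"

text \<open>The division below is exact for \<open>j\<close> in \<open>{1..m}\<close>.\<close>

definition weighted_block ::
    "nat \<Rightarrow> (nat \<Rightarrow> nat) \<Rightarrow> (nat \<Rightarrow> 'a set) \<Rightarrow> nat \<Rightarrow> 'a multiset" where
  "weighted_block m k B j = repeat_mset (lcm_sizes m k div k j) (mset_set (B j))"

definition weighted_diffs_bounded ::
    "nat \<Rightarrow> (nat \<Rightarrow> nat) \<Rightarrow> (nat \<Rightarrow> 'a::{ab_group_add,finite} set) \<Rightarrow> nat \<Rightarrow> bool" where
  "weighted_diffs_bounded m k B c \<longleftrightarrow>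
     (\<Sum>(i, j) \<in> {(i, j). i \<in> {1..m} \<and> j \<in> {1..m} \<and> i \<noteq> j}.
        diff_mset (mset_set (B i)) (weighted_block m k B j))
     \<subseteq># repeat_mset c (mset_set (UNIV - {0}))"

definition BSWEDF ::
    "nat \<Rightarrow> nat \<Rightarrow> (nat \<Rightarrow> nat) \<Rightarrow> nat \<Rightarrow> nat \<Rightarrow> (nat \<Rightarrow> 'a::{ab_group_add,finite} set) \<Rightarrow> bool" where
  "BSWEDF n m K a c B \<longleftrightarrow>
     disjoint_blocks n m K B \<and> a = (\<Sum>i=1..m. K i) \<and>
     c > 0 \<and> weighted_diffs_bounded m K B c \<and>
     (\<forall>d>0. weighted_diffs_bounded m K B d \<longrightarrow> c \<le> d)"

end

theory Submission
  imports Defs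
begin

text \<open>
  Grouping the weighted differences by the second index \<open>j\<close> and using
  \<open>D(M, N) = - D(N, M)\<close> turns them into the sum over \<open>j\<close> of \<open>w\<^sub>j = lcm / k\<^sub>j\<close> copies of the negated
  external differences of \<open>B\<^sub>j\<close>.  As \<open>G - {0}\<close> is closed under negation, \<open>\<Sum>\<^sub>j w\<^sub>j l\<^sub>j\<close> is an
  admissible bound, positive since \<open>m \<ge> 2\<close>; the least positive one is at most that.
\<close>

lemma diff_mset_union_right: "diff_mset M (N + N') = diff_mset M N + diff_mset M N'"
  by (simp add: diff_mset_def sum_mset.distrib)

lemma diff_mset_empty_right [simp]: "diff_mset M {#} = {#}"
  by (simp add: diff_mset_def)

lemma diff_mset_repeat_right: "diff_mset M (repeat_mset c N) = repeat_mset c (diff_mset M N)"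
  by (induction c) (simp_all add: diff_mset_union_right)

lemma diff_mset_add_mset_left:
  "diff_mset (add_mset x M) N = image_mset (\<lambda>y. x - y) N + diff_mset M N"
  by (simp add: diff_mset_def)

lemma diff_mset_add_mset_right:
  "diff_mset M (add_mset y N) = image_mset (\<lambda>x. x - y) M + diff_mset M N"
  by (induction M) (simp_all add: diff_mset_def)

text \<open>Termwise this is \<open>x - y = - (y - x)\<close>. The induction peels \<open>x\<close>
  off the left argument on one side and off the right argument on the other.\<close>

lemma diff_mset_commute: "diff_mset M N = image_mset uminus (diff_mset N M)"
proof (induction M)
  case empty
  show ?case by (simp add: diff_mset_def)
next
  case (add x M)
  then show ?case
    by (simp add: diff_mset_add_mset_left diff_mset_add_mset_right multiset.map_comp comp_def)
qed

lemma diff_mset_eq_empty_iff: "diff_mset M N = {#} \<longleftrightarrow> M = {#} \<or> N = {#}"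
  by (induction M) (auto simp: diff_mset_def)

lemma image_mset_sum: "image_mset f (\<Sum>i\<in>A. g i) = (\<Sum>i\<in>A. image_mset f (g i))"
  by (induction A rule: infinite_finite_induct) simp_all

lemma repeat_mset_sum_right: "repeat_mset c (\<Sum>i\<in>A. g i) = (\<Sum>i\<in>A. repeat_mset c (g i))"
  by (induction A rule: infinite_finite_induct) simp_all

lemma repeat_mset_sum_left: "repeat_mset (\<Sum>i\<in>A. c i) M = (\<Sum>i\<in>A. repeat_mset (c i) M)"
  by (induction A rule: infinite_finite_induct) (simp_all add: left_add_mult_distrib_mset)

lemma sum_mset_subseteq_mono:
  "(\<And>i. i \<in> A \<Longrightarrow> f i \<subseteq># g i) \<Longrightarrow> (\<Sum>i\<in>A. f i) \<subseteq># (\<Sum>i\<in>A. g i)"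
  by (induction A rule: infinite_finite_induct) (auto intro: subset_mset.add_mono)

text \<open>Negation is injective and fixes 0, so it permutes the nonzero elements without creating
  multiplicities.\<close>

lemma image_mset_uminus_nonzero:
  "image_mset uminus (mset_set (UNIV - {0 :: 'a :: {ab_group_add,finite}})) = mset_set (UNIV - {0})"
proof -
  have "uminus ` (UNIV - {0 :: 'a}) = UNIV - {0}"
    by (simp add: image_set_diff)
  then show ?thesis
    by (simp add: image_mset_mset_set)
qed

lemma weighted_diffs_regroup:
  "(\<Sum>(i, j) \<in> {(i, j). i \<in> {1..m} \<and> j \<in> {1..m} \<and> i \<noteq> j}.
      diff_mset (mset_set (B i)) (weighted_block m k B j)) =
   (\<Sum>j=1..m. repeat_mset (lcm_sizes m k div k j)
      (image_mset uminus (\<Sum>i\<in>{1..m} - {j}. diff_mset (mset_set (B j)) (mset_set (B i)))))"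
  (is "?L = ?R")
proof -
  let ?w = "\<lambda>j. lcm_sizes m k div k j"
  \<comment> \<open>Used from right to left, \<open>diff_mset_commute\<close> absorbs the negation
    in each summand by exchanging the two blocks.\<close>
  have "?R = (\<Sum>j=1..m. \<Sum>i\<in>{1..m} - {j}.
      repeat_mset (?w j) (diff_mset (mset_set (B i)) (mset_set (B j))))"
    by (simp add: image_mset_sum repeat_mset_sum_right flip: diff_mset_commute)
  also have "\<dots> = (\<Sum>(j, i) \<in> (SIGMA j:{1..m}. {1..m} - {j}).
      repeat_mset (?w j) (diff_mset (mset_set (B i)) (mset_set (B j))))"
    by (simp add: sum.Sigma)
  \<comment> \<open>The pairs are listed here as \<open>(j, i)\<close> and in \<open>?L\<close> as
    \<open>(i, j)\<close>; \<open>prod.swap\<close> matches them.\<close>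
  also have "\<dots> = ?L"
    by (rule sum.reindex_bij_witness [where i = prod.swap and j = prod.swap])
      (auto simp: weighted_block_def diff_mset_repeat_right)
  finally show ?thesis ..
qed

lemma BGSEDF_weighted_diffs_bounded:
  assumes "BGSEDF n m k l B"
  shows "weighted_diffs_bounded m k B (\<Sum>j=1..m. lcm_sizes m k div k j * l j)"
proof -
  let ?U = "mset_set (UNIV - {0 :: 'a})"
  have "image_mset uminus (\<Sum>i\<in>{1..m} - {j}. diff_mset (mset_set (B j)) (mset_set (B i)))
      \<subseteq># repeat_mset (l j) ?U" if "j \<in> {1..m}" for j
  proof -
    have "image_mset uminus (repeat_mset c ?U) = repeat_mset c ?U" for c
      by (induction c) (simp_all add: image_mset_uminus_nonzero)
    moreover have "(\<Sum>i\<in>{1..m} - {j}. diff_mset (mset_set (B j)) (mset_set (B i)))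
        \<subseteq># repeat_mset (l j) ?U"
      using assms that by (simp add: BGSEDF_def)
    ultimately show ?thesis
      by (metis image_mset_subseteq_mono)
  qed
  \<comment> \<open>Scaling by \<open>c\<close> multiplies every multiplicity, so it preserves the
    inclusion; \<open>c\<close> will be the weight of block \<open>j\<close>.\<close>
  then have "repeat_mset c (image_mset uminus
        (\<Sum>i\<in>{1..m} - {j}. diff_mset (mset_set (B j)) (mset_set (B i))))
      \<subseteq># repeat_mset (c * l j) ?U" if "j \<in> {1..m}" for c j
    using that by (simp add: subseteq_mset_def mult.assoc)
  then show ?thesis
    unfolding weighted_diffs_bounded_def weighted_diffs_regroup repeat_mset_sum_left
    by (intro sum_mset_subseteq_mono)
qed

text \<open>The second index \<open>j\<close> supplies a nonempty multiset of differences, which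
  does not fit into zero copies of the nonzero elements.\<close>

lemma BGSEDF_bound_pos:
  assumes "BGSEDF n m k l B" and "i \<in> {1..m}" and "j \<in> {1..m}" and "i \<noteq> j"
  shows "l i > 0"
proof (rule ccontr)
  assume "\<not> l i > 0"
  then have "l i = 0"
    by simp
  moreover have "(\<Sum>j\<in>{1..m} - {i}. diff_mset (mset_set (B i)) (mset_set (B j)))
      \<subseteq># repeat_mset (l i) (mset_set (UNIV - {0}))"
    using assms(1,2) unfolding BGSEDF_def by blast
  ultimately have "(\<Sum>j\<in>{1..m} - {i}. diff_mset (mset_set (B i)) (mset_set (B j))) = {#}"
    by simp
  \<comment> \<open>An empty sum of multisets has only empty summands; the one for \<open>j\<close>
    is split off.\<close>
  then have "diff_mset (mset_set (B i)) (mset_set (B j)) = {#}"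
    using assms by (simp add: sum.remove [of _ j])
  then show False
    using assms by (auto simp: diff_mset_eq_empty_iff mset_set_empty_iff BGSEDF_def disjoint_blocks_def)
qed

theorem lemma8:
  fixes B :: "nat \<Rightarrow> 'a::{ab_group_add,finite} set"
    and n m :: nat and k l :: "nat \<Rightarrow> nat"
  assumes "m \<ge> 2"
    and "BGSEDF n m k l B"
  shows "\<exists>c::nat. BSWEDF n m k (\<Sum>i=1..m. k i) c B \<and>
           real c \<le> (\<Sum>i=1..m. real (l i) * real (lcm_sizes m k) / real (k i))"
proof -
  let ?w = "\<lambda>j. lcm_sizes m k div k j"
  let ?c = "\<Sum>j=1..m. ?w j * l j"
  let ?P = "\<lambda>c. c > 0 \<and> weighted_diffs_bounded m k B c"
  have blocks: "disjoint_blocks n m k B"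
    using assms(2) by (simp add: BGSEDF_def)
  have k_pos: "k j > 0" if "j \<in> {1..m}" for j
    using blocks that unfolding disjoint_blocks_def by (metis card_gt_0_iff finite)
  have k_dvd: "k j dvd lcm_sizes m k" if "j \<in> {1..m}" for j
    using that by (auto simp: lcm_sizes_def)
  \<comment> \<open>The \<open>Lcm\<close> of a finite set of naturals vanishes only if 0 is a
    member.\<close>
  have "lcm_sizes m k > 0"
    using k_pos by (force simp: lcm_sizes_def Lcm_0_iff intro!: Nat.gr0I)
  \<comment> \<open>Since \<open>m \<ge> 2\<close>, blocks 1 and 2 both exist, which gives
    \<open>l 1 > 0\<close>. The weight is positive because \<open>k 1\<close> divides a positive
    number and hence is at most that number.\<close>
  then have "?w 1 * l 1 > 0"
    using assms BGSEDF_bound_pos [OF assms(2), of 1 2] k_pos [of 1] k_dvd [of 1]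
    by (auto simp: div_greater_zero_iff dvd_imp_le)
  then have "?c > 0"
    using assms(1) by (subst sum_pos2 [of _ 1]) auto
  then have P: "?P ?c"
    using BGSEDF_weighted_diffs_bounded [OF assms(2)] by blast
  \<comment> \<open>Positivity is part of \<open>?P\<close>, so its least element is the smallest
    positive bound; \<open>?c\<close> shows that one exists.\<close>
  have "BSWEDF n m k (\<Sum>i=1..m. k i) (LEAST c. ?P c) B"
    using blocks LeastI [of ?P, OF P] by (auto simp: BSWEDF_def intro: Least_le)
  moreover have "real (LEAST c. ?P c) \<le> (\<Sum>i=1..m. real (l i) * real (lcm_sizes m k) / real (k i))"
  proof -
    have "real (LEAST c. ?P c) \<le> real ?c"
      using Least_le [of ?P, OF P] by (rule of_nat_mono)
    also have "\<dots> = (\<Sum>i=1..m. real (l i) * real (lcm_sizes m k) / real (k i))"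
      unfolding of_nat_sum
      \<comment> \<open>Divisibility makes the natural-number quotient agree with the real
        one.\<close>
      by (intro sum.cong) (use k_dvd in \<open>simp_all add: real_of_nat_div\<close>)
    finally show ?thesis .
  qed
  ultimately show ?thesis by blast
qed

end
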